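(* Let $A$ be an $n\times n$ Hermitian matrix ($n\ge2$) with eigenvalues $\lambda_1\ge\dots\ge\lambda_n$ and corresponding orthonormal eigenvectors $v_1,\dots,v_n$, $v_{i,k}$ the $k$-th component of $v_i$. For $k=1,\dots,n$ let $\mu_{k,1}\ge\dots\ge\mu_{k,n-1}$ be the eigenvalues of $A_k$. Fix $1\le\ell\le r\le n-1$, let $U^k_\ell:=\sum_{i=\ell}^n|v_{i,k}|^2$, $L^k_{r+1}:=\sum_{i=1}^{r+1}|v_{i,k}|^2$, and assume $U^k_\ell\ne0$ and $L^k_{r+1}\ne0$ for all $k=1,\dots,n$. Define $\Omega_j(\ell):=\sum_{k=1}^n\frac{|v_{j,k}|^2}{U^k_\ell}$ and $\Psi_j(r):=\sum_{k=1}^n\frac{|v_{j,k}|^2}{L^k_{r+1}}$. Then $$n\sum_{j=\ell}^r\lambda_{j+1}+\sum_{j=\ell}^r(\lambda_\ell-\lambda_{j+1})\Psi_{j+1}(r)\le\sum_{k=1}^n\sum_{j=\ell}^r\mu_{k,j}\le n\sum_{j=\ell}^r\lambda_j-\sum_{j=\ell}^r(\lambda_j-\lambda_{r+1})\Omega_j(\ell).$$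
   Context: For an $n\times n$ matrix $A$ and $k\in\{1,\dots,n\}$, $A_k$ denotes the $(n-1)\times(n-1)$ principal submatrix obtained by deleting the $k$-th row and $k$-th column of $A$. *)

theory Defs
  imports "Jordan_Normal_Form.Char_Poly" "Jordan_Normal_Form.Gram_Schmidt"
begin

definition hermitian_mat :: "complex mat \<Rightarrow> nat \<Rightarrow> bool" where
  "hermitian_mat A n \<longleftrightarrow> A \<in> carrier_mat n n \<and>
     (\<forall>i<n. \<forall>j<n. A $$ (i,j) = cnj (A $$ (j,i)))"

(* A_k : principal submatrix deleting the k-th row and column, k in {1..n} (1-based) *)
definition principal_sub :: "complex mat \<Rightarrow> nat \<Rightarrow> complex mat" where
  "principal_sub A k = mat_delete A (k - 1) (k - 1)"

end

theory Submission
  imports Defs "Jordan_Normal_Form.Schur_Decomposition"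
begin

text \<open>
  The inequalities hold for every \<open>k\<close> separately and are then summed. In the eigenbasis \<open>v\<close> of \<open>A\<close>,
  let \<open>a\<close> be the vector with entries \<open>v i $ k\<close>, and let \<open>y 1, y 2, \<dots>\<close> be orthonormal
  eigenvectors of \<open>A_k\<close>, regarded as vectors orthogonal to the \<open>k\<close>-th unit vector. Counting
  equations yields orthonormal \<open>x l, \<dots>, x r\<close> with \<open>x j\<close> in the span of \<open>y 1, \<dots>, y j\<close> and
  orthogonal to \<open>v 1, \<dots>, v (l - 1)\<close>; the first property makes the Rayleigh quotient of \<open>x j\<close>
  at least \<open>mu k j\<close>. So the sum of the \<open>mu k j\<close> is at most \<open>\<Sum> lam i * p i\<close>, where
  \<open>p i\<close> is the squared length of the projection of \<open>v i\<close> to the span of the \<open>x j\<close>. All \<open>x j\<close> are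
  orthogonal to the projection of the \<open>k\<close>-th unit vector to the span of \<open>v l, \<dots>, v n\<close>, hence
  Bessel's inequality gives \<open>p i \<le> 1 - |a i|^2 / U k\<close>. Maximising the linear functional
  \<open>\<Sum> lam i * p i\<close> under these constraints and \<open>\<Sum> p i = r - l + 1\<close> gives the upper bound.
  The lower bound is the upper bound for \<open>- A\<close>.
\<close>

section \<open>Underdetermined linear systems over finite index sets\<close>

text \<open>Gaussian elimination, by induction on the equations: an equation with a nonzero
  coefficient at a pivot \<open>p\<close> is solved for \<open>c p\<close> and substituted into the
  others, which removes one equation and one unknown.\<close>

lemma homogeneous_system_nontrivial:
  fixes f :: "'e \<Rightarrow> 't \<Rightarrow> 'a::field"
  assumes "finite E" "finite T" "card E < card T"
  shows "\<exists>c. (\<exists>t\<in>T. c t \<noteq> 0) \<and> (\<forall>e\<in>E. (\<Sum>t\<in>T. f e t * c t) = 0)"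
  using assms
proof (induction E arbitrary: T f rule: finite_induct)
  case empty
  then obtain t where "t \<in> T" by fastforce
  then show ?case by (intro exI[of _ "\<lambda>_. 1"]) auto
next
  case (insert e E)
  show ?case
  proof (cases "\<forall>t\<in>T. f e t = 0")
    case True
    have "card E < card T" using insert by simp
    from insert.IH[OF insert.prems(1) this, of f] obtain c
      where "\<exists>t\<in>T. c t \<noteq> 0" "\<forall>d\<in>E. (\<Sum>t\<in>T. f d t * c t) = 0" by blast
    moreover have "(\<Sum>t\<in>T. f e t * c t) = 0" using True by simp
    ultimately show ?thesis by blast
  next
    case False
    then obtain p where p: "p \<in> T" "f e p \<noteq> 0" by auto
    let ?T = "T - {p}"
    have "card E < card ?T" using insert p by simp
    from insert.IH[OF _ this, of "\<lambda>d t. f d t - f d p * f e t / f e p"] insert.prems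
    obtain c where c: "\<exists>t\<in>?T. c t \<noteq> 0"
      "\<And>d. d \<in> E \<Longrightarrow> (\<Sum>t\<in>?T. (f d t - f d p * f e t / f e p) * c t) = 0" by auto
    define s where "s = (\<Sum>t\<in>?T. f e t * c t)"
    \<comment> \<open>The pivot value is the one that equation \<open>e\<close> forces once the
      other unknowns are known.\<close>
    define c' where "c' = c(p := - s / f e p)"
    have split: "(\<Sum>t\<in>T. f d t * c' t) = (\<Sum>t\<in>?T. f d t * c t) - f d p * s / f e p" for d
    proof -
      have "(\<Sum>t\<in>T. f d t * c' t) = f d p * c' p + (\<Sum>t\<in>?T. f d t * c' t)"
        using insert.prems(1) p(1) by (rule sum.remove)
      moreover have "(\<Sum>t\<in>?T. f d t * c' t) = (\<Sum>t\<in>?T. f d t * c t)"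
        by (rule sum.cong) (auto simp: c'_def)
      ultimately show ?thesis by (simp add: c'_def)
    qed
    have "(\<Sum>t\<in>T. f d t * c' t) = 0" if "d \<in> insert e E" for d
    proof (cases "d = e")
      case True
      then show ?thesis using p by (simp add: split s_def)
    next
      case False
      then have "(\<Sum>t\<in>?T. (f d t - f d p * f e t / f e p) * c t) = 0" using that c by auto
      moreover have "(\<Sum>t\<in>?T. (f d t - f d p * f e t / f e p) * c t)
          = (\<Sum>t\<in>?T. f d t * c t) - f d p / f e p * s"
        unfolding s_def sum_distrib_left sum_subtractf[symmetric]
        by (rule sum.cong) (auto simp: algebra_simps)
      ultimately show ?thesis by (simp add: split)
    qed
    moreover have "\<exists>t\<in>T. c' t \<noteq> 0" using c(1) by (auto simp: c'_def)
    ultimately show ?thesis by blast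
  qed
qed

lemma sum_mult_cnj_self:
  "(\<Sum>i\<in>I. z i * cnj (z i)) = complex_of_real (\<Sum>i\<in>I. (cmod (z i))\<^sup>2)"
  unfolding of_real_sum complex_norm_square ..

text \<open>There are fewer conditions than coefficients, so a nontrivial combination satisfies them
  all; independence makes it a nonzero vector, which can be normalised. The pairing with
  \<open>g e\<close> has no conjugate, so orthogonality to a vector is expressed by passing its
  conjugate as \<open>g e\<close>.\<close>

lemma unit_vector_in_span:
  fixes p :: "'t \<Rightarrow> 'i \<Rightarrow> complex" and g :: "'e \<Rightarrow> 'i \<Rightarrow> complex"
  assumes fin: "finite I" "finite E" "finite T" and card: "card E < card T"
    and indep: "\<And>c. (\<And>i. i \<in> I \<Longrightarrow> (\<Sum>t\<in>T. c t * p t i) = 0) \<Longrightarrow> \<forall>t\<in>T. c t = 0"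
  obtains c where "(\<Sum>i\<in>I. (cmod (\<Sum>t\<in>T. c t * p t i))\<^sup>2) = 1"
    and "\<And>e. e \<in> E \<Longrightarrow> (\<Sum>i\<in>I. (\<Sum>t\<in>T. c t * p t i) * g e i) = 0"
proof -
  from homogeneous_system_nontrivial[OF fin(2,3) card, of "\<lambda>e t. \<Sum>i\<in>I. p t i * g e i"]
  obtain c where c: "\<exists>t\<in>T. c t \<noteq> 0"
    "\<And>e. e \<in> E \<Longrightarrow> (\<Sum>t\<in>T. (\<Sum>i\<in>I. p t i * g e i) * c t) = 0" by auto
  define x where "x i = (\<Sum>t\<in>T. c t * p t i)" for i
  define s where "s = sqrt (\<Sum>i\<in>I. (cmod (x i))\<^sup>2)"
  have "\<exists>i\<in>I. x i \<noteq> 0" using indep[of c] c(1) unfolding x_def by blast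
  then have pos: "(\<Sum>i\<in>I. (cmod (x i))\<^sup>2) > 0"
    using fin(1) by (auto intro: sum_pos2)
  then have s: "s > 0" "s\<^sup>2 = (\<Sum>i\<in>I. (cmod (x i))\<^sup>2)" by (auto simp: s_def)
  define d where "d t = c t / of_real s" for t
  have dx: "(\<Sum>t\<in>T. d t * p t i) = x i / of_real s" for i
    by (simp add: d_def x_def sum_divide_distrib)
  show ?thesis
  proof
    show "(\<Sum>i\<in>I. (cmod (\<Sum>t\<in>T. d t * p t i))\<^sup>2) = 1"
      using s pos by (simp add: dx norm_divide power_divide sum_divide_distrib[symmetric])
    fix e assume e: "e \<in> E"
    have "(\<Sum>i\<in>I. x i * g e i) = (\<Sum>t\<in>T. (\<Sum>i\<in>I. p t i * g e i) * c t)"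
      unfolding x_def sum_distrib_right
      by (subst sum.swap) (simp add: algebra_simps)
    then have "(\<Sum>i\<in>I. x i * g e i) = 0" using c(2)[OF e] by simp
    then show "(\<Sum>i\<in>I. (\<Sum>t\<in>T. d t * p t i) * g e i) = 0"
      by (simp add: dx sum_divide_distrib[symmetric])
  qed
qed

section \<open>Orthonormal families and Bessel's inequality\<close>

text \<open>The vector \<open>w\<close> is the projection of the \<open>i0\<close>-th unit vector to
  the span of the \<open>x j\<close>. Both its squared norm and its entry at \<open>i0\<close> equal
  the sum \<open>S\<close> in question, hence \<open>S^2 \<le> S\<close>.\<close>

lemma bessel_coordinate:
  fixes x :: "'j \<Rightarrow> 'i \<Rightarrow> complex"
  assumes fin: "finite I" "finite J"
    and orth: "\<And>j j'. j \<in> J \<Longrightarrow> j' \<in> J \<Longrightarrow>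
      (\<Sum>i\<in>I. x j i * cnj (x j' i)) = (if j = j' then 1 else 0)"
    and i0: "i0 \<in> I"
  shows "(\<Sum>j\<in>J. (cmod (x j i0))\<^sup>2) \<le> 1"
proof -
  define S where "S = (\<Sum>j\<in>J. (cmod (x j i0))\<^sup>2)"
  define w where "w i = (\<Sum>j\<in>J. cnj (x j i0) * x j i)" for i
  have w0: "w i0 = of_real S"
    unfolding w_def S_def of_real_sum complex_norm_square by (simp add: mult.commute)
  have "(\<Sum>i\<in>I. w i * cnj (w i))
      = (\<Sum>i\<in>I. \<Sum>j\<in>J. \<Sum>j'\<in>J. cnj (x j i0) * x j' i0 * (x j i * cnj (x j' i)))"
    by (simp add: w_def sum_product algebra_simps)
  also have "\<dots> = (\<Sum>j\<in>J. \<Sum>j'\<in>J. \<Sum>i\<in>I. cnj (x j i0) * x j' i0 * (x j i * cnj (x j' i)))"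
    by (subst sum.swap) (rule sum.cong[OF refl], rule sum.swap)
  also have "\<dots> = (\<Sum>j\<in>J. \<Sum>j'\<in>J. if j = j' then cnj (x j i0) * x j' i0 else 0)"
    unfolding sum_distrib_left[symmetric] by (intro sum.cong refl) (simp add: orth)
  also have "\<dots> = of_real S"
    unfolding S_def of_real_sum complex_norm_square using fin by (simp add: mult.commute)
  finally have "complex_of_real (\<Sum>i\<in>I. (cmod (w i))\<^sup>2) = of_real S"
    unfolding sum_mult_cnj_self .
  then have "S = (\<Sum>i\<in>I. (cmod (w i))\<^sup>2)" by (simp only: of_real_eq_iff)
  also have "\<dots> \<ge> (cmod (w i0))\<^sup>2"
    using fin i0 by (intro member_le_sum) auto
  finally have "S\<^sup>2 \<le> S" by (simp add: w0)
  moreover have "S < S\<^sup>2" if "1 < S"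
    using mult_strict_left_mono[OF that, of S] that by (simp add: power2_eq_square)
  ultimately have "S \<le> 1" by fastforce
  then show ?thesis by (simp add: S_def)
qed

text \<open>A weighted form that is diagonal on the family \<open>Y\<close> has no cross terms on
  combinations. Weights 1 give the squared norm, weights \<open>lam\<close> the numerator of the
  Rayleigh quotient.\<close>

lemma sum_combination_form:
  fixes Y :: "'t \<Rightarrow> 'i \<Rightarrow> complex" and h :: "'i \<Rightarrow> complex"
  assumes fin: "finite T" "finite I"
    and diag: "\<And>s t. s \<in> T \<Longrightarrow> t \<in> T \<Longrightarrow>
      (\<Sum>i\<in>I. h i * (Y s i * cnj (Y t i))) = (if s = t then m s else 0)"
  shows "(\<Sum>i\<in>I. h i * of_real ((cmod (\<Sum>t\<in>T. c t * Y t i))\<^sup>2))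
      = (\<Sum>t\<in>T. m t * of_real ((cmod (c t))\<^sup>2))"
proof -
  have "of_real ((cmod (\<Sum>t\<in>T. c t * Y t i))\<^sup>2)
      = (\<Sum>s\<in>T. \<Sum>t\<in>T. (c s * Y s i) * (cnj (c t) * cnj (Y t i)))" for i
    unfolding sum_product[symmetric] complex_norm_square by simp
  then have "(\<Sum>i\<in>I. h i * of_real ((cmod (\<Sum>t\<in>T. c t * Y t i))\<^sup>2))
      = (\<Sum>i\<in>I. \<Sum>s\<in>T. \<Sum>t\<in>T. c s * cnj (c t) * (h i * (Y s i * cnj (Y t i))))"
    by (simp add: sum_distrib_left mult_ac)
  also have "\<dots> = (\<Sum>s\<in>T. \<Sum>t\<in>T. \<Sum>i\<in>I. c s * cnj (c t) * (h i * (Y s i * cnj (Y t i))))"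
    by (subst sum.swap) (rule sum.cong[OF refl], rule sum.swap)
  also have "\<dots> = (\<Sum>s\<in>T. \<Sum>t\<in>T. if s = t then c s * cnj (c t) * m s else 0)"
    unfolding sum_distrib_left[symmetric] by (intro sum.cong refl) (simp add: diag)
  also have "\<dots> = (\<Sum>t\<in>T. m t * of_real ((cmod (c t))\<^sup>2))"
    unfolding complex_norm_square using fin by (simp add: mult_ac)
  finally show ?thesis .
qed

lemma orthonormal_combination_eq_0:
  fixes Y :: "'t \<Rightarrow> 'i \<Rightarrow> complex"
  assumes fin: "finite T" "finite I"
    and orth: "\<And>s t. s \<in> T \<Longrightarrow> t \<in> T \<Longrightarrow>
      (\<Sum>i\<in>I. Y s i * cnj (Y t i)) = (if s = t then 1 else 0)"
    and zero: "\<And>i. i \<in> I \<Longrightarrow> (\<Sum>t\<in>T. c t * Y t i) = 0"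
  shows "\<forall>t\<in>T. c t = 0"
proof -
  have "(\<Sum>i\<in>I. 1 * complex_of_real ((cmod (\<Sum>t\<in>T. c t * Y t i))\<^sup>2))
      = (\<Sum>t\<in>T. 1 * of_real ((cmod (c t))\<^sup>2))"
    by (rule sum_combination_form) (use fin orth in auto)
  then have "complex_of_real (\<Sum>t\<in>T. (cmod (c t))\<^sup>2) = 0"
    using zero by simp
  then have "(\<Sum>t\<in>T. (cmod (c t))\<^sup>2) = 0" by (simp only: of_real_eq_0_iff)
  then show ?thesis using fin by (simp add: sum_nonneg_eq_0_iff)
qed

text \<open>The \<open>j\<close>-th vector ranges over a \<open>j\<close>-dimensional space and has to satisfy
  \<open>l - 1\<close> prescribed equations and be orthogonal to its \<open>j - l\<close> predecessors.\<close>

lemma orthonormal_vectors_in_flag: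
  fixes Y :: "nat \<Rightarrow> 'i \<Rightarrow> complex" and g :: "nat \<Rightarrow> 'i \<Rightarrow> complex"
  assumes fin: "finite I"
    and orth: "\<And>s t. s \<in> {1..N} \<Longrightarrow> t \<in> {1..N} \<Longrightarrow>
      (\<Sum>i\<in>I. Y s i * cnj (Y t i)) = (if s = t then 1 else 0)"
    and l: "1 \<le> l" and q: "q \<le> Suc N"
  shows "\<exists>x. (\<forall>j\<in>{l..<q}. \<exists>c. x j = (\<lambda>i. \<Sum>t\<in>{1..j}. c t * Y t i)) \<and>
    (\<forall>j\<in>{l..<q}. \<forall>e\<in>{1..<l}. (\<Sum>i\<in>I. x j i * g e i) = 0) \<and>
    (\<forall>j\<in>{l..<q}. \<forall>j'\<in>{l..<q}. (\<Sum>i\<in>I. x j i * cnj (x j' i)) = (if j = j' then 1 else 0))"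
  using q
proof (induction q)
  case 0
  then show ?case by simp
next
  case (Suc q)
  show ?case
  proof (cases "l \<le> q")
    case False
    then show ?thesis by simp
  next
    case True
    from Suc.IH[OF Suc_leD[OF Suc.prems]] obtain x where
      x: "\<And>j. j \<in> {l..<q} \<Longrightarrow> \<exists>c. x j = (\<lambda>i. \<Sum>t\<in>{1..j}. c t * Y t i)"
        "\<And>j e. j \<in> {l..<q} \<Longrightarrow> e \<in> {1..<l} \<Longrightarrow> (\<Sum>i\<in>I. x j i * g e i) = 0"
        "\<And>j j'. j \<in> {l..<q} \<Longrightarrow> j' \<in> {l..<q} \<Longrightarrow>
          (\<Sum>i\<in>I. x j i * cnj (x j' i)) = (if j = j' then 1 else 0)"
      by blast
    \<comment> \<open>One family over \<open>{1..<q}\<close> carries both kinds of conditions: the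
      prescribed ones below \<open>l\<close> and orthogonality to the earlier vectors from
      \<open>l\<close> on. These are \<open>q - 1\<close> equations in \<open>q\<close>
      coefficients.\<close>
    define f where "f e i = (if e < l then g e i else cnj (x e i))" for e i
    have "\<forall>t\<in>{1..q}. c t = 0" if "\<And>i. i \<in> I \<Longrightarrow> (\<Sum>t\<in>{1..q}. c t * Y t i) = 0" for c
      by (rule orthonormal_combination_eq_0[OF finite_atLeastAtMost fin orth that])
        (use Suc.prems in auto)
    then obtain c where
      c: "(\<Sum>i\<in>I. (cmod (\<Sum>t\<in>{1..q}. c t * Y t i))\<^sup>2) = 1"
        "\<And>e. e \<in> {1..<q} \<Longrightarrow> (\<Sum>i\<in>I. (\<Sum>t\<in>{1..q}. c t * Y t i) * f e i) = 0"
      using unit_vector_in_span[OF fin, of "{1..<q}" "{1..q}" Y f] True l by auto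
    define z where "z i = (\<Sum>t\<in>{1..q}. c t * Y t i)" for i
    have zz: "(\<Sum>i\<in>I. z i * cnj (z i)) = 1"
      using c(1) by (simp only: sum_mult_cnj_self z_def of_real_1)
    have zg: "(\<Sum>i\<in>I. z i * g e i) = 0" if "e \<in> {1..<l}" for e
      using c(2)[of e] that True by (simp add: z_def f_def)
    have zx: "(\<Sum>i\<in>I. z i * cnj (x j i)) = 0" if "j \<in> {l..<q}" for j
      using c(2)[of j] that l by (simp add: z_def f_def)
    have xz: "(\<Sum>i\<in>I. x j i * cnj (z i)) = 0" if "j \<in> {l..<q}" for j
      using arg_cong[OF zx[OF that], of cnj] by (simp add: mult.commute)
    have ins: "{l..<Suc q} = insert q {l..<q}" using True by auto
    show ?thesis
    proof (intro exI[of _ "x(q := z)"] conjI ballI)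
      fix j assume j: "j \<in> {l..<Suc q}"
      show "\<exists>c. (x(q := z)) j = (\<lambda>i. \<Sum>t\<in>{1..j}. c t * Y t i)"
        using x(1) j z_def by (cases "j = q") auto
      show "(\<Sum>i\<in>I. (x(q := z)) j i * g e i) = 0" if "e \<in> {1..<l}" for e
        using x(2) j that zg by (cases "j = q") auto
      fix j' assume j': "j' \<in> {l..<Suc q}"
      consider "j = q" "j' = q" | "j = q" "j' \<in> {l..<q}" | "j \<in> {l..<q}" "j' = q"
        | "j \<in> {l..<q}" "j' \<in> {l..<q}"
        using j j' unfolding ins by blast
      then show "(\<Sum>i\<in>I. (x(q := z)) j i * cnj ((x(q := z)) j' i)) = (if j = j' then 1 else 0)"
      proof cases
        case 1
        then show ?thesis using zz by simp
      next
        case 2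
        then show ?thesis using zx[of j'] by simp
      next
        case 3
        then show ?thesis using xz[of j] by simp
      next
        case 4
        then show ?thesis using x(3)[of j j'] by simp
      qed
    qed
  qed
qed

section \<open>Block sums of eigenvalues in eigenbasis coordinates\<close>

text \<open>A Hermitian form \<open>A\<close> on \<open>\<complex>\<^sup>n\<close> in the coordinates of an orthonormal eigenbasis, so that it is
  given by the weights \<open>lam\<close>; \<open>Y\<close> is an orthonormal basis of the hyperplane \<open>\<Sum> x i * a i = 0\<close>
  that diagonalises the compression of \<open>A\<close>, with eigenvalues \<open>mu\<close>.\<close>

locale bordered_spectrum =
  fixes n :: nat and lam mu :: "nat \<Rightarrow> real"
    and Y :: "nat \<Rightarrow> nat \<Rightarrow> complex" and a :: "nat \<Rightarrow> complex"
  assumes orth: "\<And>s t. s \<in> {1..n-1} \<Longrightarrow> t \<in> {1..n-1} \<Longrightarrow>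
      (\<Sum>i=1..n. Y s i * cnj (Y t i)) = (if s = t then 1 else 0)"
    and diag: "\<And>s t. s \<in> {1..n-1} \<Longrightarrow> t \<in> {1..n-1} \<Longrightarrow>
      (\<Sum>i=1..n. of_real (lam i) * (Y s i * cnj (Y t i))) = (if s = t then of_real (mu s) else 0)"
    and perp: "\<And>t. t \<in> {1..n-1} \<Longrightarrow> (\<Sum>i=1..n. Y t i * a i) = 0"
    and lam_dec: "\<And>i j. 1 \<le> i \<Longrightarrow> i \<le> j \<Longrightarrow> j \<le> n \<Longrightarrow> lam j \<le> lam i"
    and mu_dec: "\<And>i j. 1 \<le> i \<Longrightarrow> i \<le> j \<Longrightarrow> j \<le> n - 1 \<Longrightarrow> mu j \<le> mu i"
begin

text \<open>Without the subtracted sum, which is nonnegative, this is Cauchy interlacing summed over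
  a block. The gain comes from the hyperplane condition, which limits the weight that the trial
  vectors can place on each coordinate.\<close>

lemma block_sum_upper:
  assumes lr: "1 \<le> l" "l \<le> r" "r \<le> n - 1"
    and U_nz: "(\<Sum>i=l..n. (cmod (a i))\<^sup>2) \<noteq> 0"
  shows "(\<Sum>j=l..r. mu j) \<le> (\<Sum>j=l..r. lam j)
    - (\<Sum>j=l..r. (lam j - lam (r+1)) * ((cmod (a j))\<^sup>2 / (\<Sum>i=l..n. (cmod (a i))\<^sup>2)))"
proof -
  define U where "U = (\<Sum>i=l..n. (cmod (a i))\<^sup>2)"
  have "U \<ge> 0" unfolding U_def by (intro sum_nonneg) auto
  then have U: "U > 0" using U_nz by (simp add: U_def)
  have rn: "r + 1 \<le> n" using lr by auto
  have J: "{l..<Suc r} = {l..r}" by auto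
  have "Suc r \<le> Suc (n - 1)" using lr by simp
  \<comment> \<open>In these coordinates, orthogonality to the \<open>e\<close>-th eigenvector of
    the form means that the entry at \<open>e\<close> vanishes, so the prescribed functionals are
    evaluations at \<open>e < l\<close>.\<close>
  from orthonormal_vectors_in_flag[OF finite_atLeastAtMost orth lr(1) this,
      of "\<lambda>e i. if i = e then 1 else 0"]
  obtain x where
    x: "\<And>j. j \<in> {l..r} \<Longrightarrow> \<exists>c. x j = (\<lambda>i. \<Sum>t\<in>{1..j}. c t * Y t i)"
      "\<And>j e. j \<in> {l..r} \<Longrightarrow> e \<in> {1..<l} \<Longrightarrow> (\<Sum>i=1..n. x j i * (if i = e then 1 else 0)) = 0"
      "\<And>j j'. j \<in> {l..r} \<Longrightarrow> j' \<in> {l..r} \<Longrightarrow>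
          (\<Sum>i=1..n. x j i * cnj (x j' i)) = (if j = j' then 1 else 0)"
    unfolding J by blast
  have x0: "x j e = 0" if "j \<in> {l..r}" "e \<in> {1..<l}" for j e
  proof -
    have "e \<in> {1..n}" using that rn lr by auto
    then show ?thesis using x(2)[OF that] by (simp add: if_distrib sum.delta cong: if_cong)
  qed
  have restrict: "(\<Sum>i=1..n. G i) = (\<Sum>i=l..n. G i)"
    if "\<And>i. i \<in> {1..<l} \<Longrightarrow> G i = 0" for G :: "nat \<Rightarrow> 'b::comm_monoid_add"
    using that lr by (intro sum.mono_neutral_right) auto
  have x_norm: "(\<Sum>i=1..n. (cmod (x j i))\<^sup>2) = 1" if "j \<in> {l..r}" for j
  proof -
    have "complex_of_real (\<Sum>i=1..n. (cmod (x j i))\<^sup>2) = of_real 1"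
      unfolding sum_mult_cnj_self[symmetric] using x(3)[OF that that] by simp
    then show ?thesis by (simp only: of_real_eq_iff)
  qed
  have x_perp: "(\<Sum>i=1..n. x j i * a i) = 0" if j: "j \<in> {l..r}" for j
  proof -
    obtain c where c: "x j = (\<lambda>i. \<Sum>t\<in>{1..j}. c t * Y t i)" using x(1)[OF j] by auto
    have "(\<Sum>i=1..n. x j i * a i) = (\<Sum>t\<in>{1..j}. c t * (\<Sum>i=1..n. Y t i * a i))"
      unfolding c sum_distrib_right sum_distrib_left
      by (subst sum.swap) (simp add: mult.assoc)
    also have "\<dots> = 0" using perp j lr by (intro sum.neutral) auto
    finally show ?thesis .
  qed
  \<comment> \<open>The Rayleigh quotient of a vector in the span of \<open>Y 1, ..., Y j\<close> is
    a convex combination of \<open>mu 1, ..., mu j\<close>, the least of which is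
    \<open>mu j\<close>.\<close>
  have mu_le: "mu j \<le> (\<Sum>i=1..n. lam i * (cmod (x j i))\<^sup>2)" if j: "j \<in> {l..r}" for j
  proof -
    obtain c where c: "x j = (\<lambda>i. \<Sum>t\<in>{1..j}. c t * Y t i)" using x(1)[OF j] by auto
    have sub: "t \<in> {1..n-1}" if "t \<in> {1..j}" for t using that j lr by auto
    have "(\<Sum>i=1..n. 1 * complex_of_real ((cmod (\<Sum>t\<in>{1..j}. c t * Y t i))\<^sup>2))
        = (\<Sum>t\<in>{1..j}. 1 * of_real ((cmod (c t))\<^sup>2))"
      by (rule sum_combination_form) (use orth sub in auto)
    then have "complex_of_real (\<Sum>i=1..n. (cmod (x j i))\<^sup>2) = of_real (\<Sum>t\<in>{1..j}. (cmod (c t))\<^sup>2)"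
      unfolding c by simp
    then have one: "(\<Sum>t\<in>{1..j}. (cmod (c t))\<^sup>2) = 1"
      using x_norm[OF j] by (simp only: of_real_eq_iff)
    have "(\<Sum>i=1..n. of_real (lam i) * complex_of_real ((cmod (\<Sum>t\<in>{1..j}. c t * Y t i))\<^sup>2))
        = (\<Sum>t\<in>{1..j}. of_real (mu t) * of_real ((cmod (c t))\<^sup>2))"
      by (rule sum_combination_form) (use diag sub in auto)
    then have "complex_of_real (\<Sum>i=1..n. lam i * (cmod (x j i))\<^sup>2)
        = of_real (\<Sum>t\<in>{1..j}. mu t * (cmod (c t))\<^sup>2)"
      unfolding c by simp
    then have "(\<Sum>i=1..n. lam i * (cmod (x j i))\<^sup>2) = (\<Sum>t\<in>{1..j}. mu t * (cmod (c t))\<^sup>2)"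
      by (simp only: of_real_eq_iff)
    also have "\<dots> \<ge> (\<Sum>t\<in>{1..j}. mu j * (cmod (c t))\<^sup>2)"
      using mu_dec j lr by (intro sum_mono mult_right_mono) auto
    finally show ?thesis using one by (simp add: sum_distrib_left[symmetric])
  qed
  define p where "p i = (\<Sum>j=l..r. (cmod (x j i))\<^sup>2)" for i
  have p_nonneg: "p i \<ge> 0" for i unfolding p_def by (intro sum_nonneg) auto
  have p0: "p i = 0" if "i \<in> {1..<l}" for i using x0 that by (simp add: p_def)
  have "(\<Sum>i=1..n. p i) = (\<Sum>j=l..r. \<Sum>i=1..n. (cmod (x j i))\<^sup>2)"
    unfolding p_def by (rule sum.swap)
  also have "\<dots> = (\<Sum>j=l..r. 1)" by (rule sum.cong[OF refl x_norm])
  finally have p_sum: "(\<Sum>i=l..n. p i) = real (card {l..r})"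
    using restrict[of p, OF p0] by simp
  \<comment> \<open>Bessel for the vectors \<open>x j\<close> together with the normalised restriction of \<open>a\<close> to \<open>{l..n}\<close>.\<close>
  have p_le: "p i \<le> 1 - (cmod (a i))\<^sup>2 / U" if i: "i \<in> {l..n}" for i
  proof -
    define z where "z = x(Suc r := (\<lambda>i. cnj (a i) / of_real (sqrt U)))"
    have zx: "z j = x j" if "j \<in> {l..r}" for j using that by (simp add: z_def)
    have zu: "z (Suc r) i = cnj (a i) / of_real (sqrt U)" for i by (simp add: z_def)
    have ux: "(\<Sum>i=l..n. x j i * cnj (z (Suc r) i)) = 0" if "j \<in> {l..r}" for j
    proof -
      have "(\<Sum>i=l..n. x j i * cnj (z (Suc r) i)) = (\<Sum>i=l..n. x j i * a i) / of_real (sqrt U)"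
        by (simp add: zu sum_divide_distrib)
      also have "(\<Sum>i=l..n. x j i * a i) = 0"
        using x_perp[OF that] restrict[of "\<lambda>i. x j i * a i"] x0[OF that] by simp
      finally show ?thesis by simp
    qed
    have xu: "(\<Sum>i=l..n. z (Suc r) i * cnj (x j i)) = 0" if "j \<in> {l..r}" for j
      using arg_cong[OF ux[OF that], of cnj] by (simp add: mult.commute)
    have "(\<Sum>i=l..n. (cmod (z (Suc r) i))\<^sup>2) = U / U"
      unfolding zu using U
      by (simp add: norm_divide power_divide sum_divide_distrib[symmetric] U_def[symmetric])
    then have uu: "(\<Sum>i=l..n. z (Suc r) i * cnj (z (Suc r) i)) = 1"
      unfolding sum_mult_cnj_self using U by simp
    have xx: "(\<Sum>i=l..n. x j i * cnj (x j' i)) = (if j = j' then 1 else 0)"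
      if "j \<in> {l..r}" "j' \<in> {l..r}" for j j'
      using x(3)[OF that] restrict[of "\<lambda>i. x j i * cnj (x j' i)"] x0[OF that(1)] by simp
    have J: "{l..Suc r} = insert (Suc r) {l..r}" using lr by auto
    have "(\<Sum>j\<in>{l..Suc r}. (cmod (z j i))\<^sup>2) \<le> 1"
    proof (rule bessel_coordinate[where I = "{l..n}"])
      fix j j' assume "j \<in> {l..Suc r}" "j' \<in> {l..Suc r}"
      then show "(\<Sum>i=l..n. z j i * cnj (z j' i)) = (if j = j' then 1 else 0)"
        unfolding J using xx ux xu uu zx by auto
    qed (use i in auto)
    moreover have "(\<Sum>j\<in>{l..Suc r}. (cmod (z j i))\<^sup>2) = (cmod (z (Suc r) i))\<^sup>2 + p i"
      unfolding J p_def by (simp add: zx)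
    moreover have "(cmod (z (Suc r) i))\<^sup>2 = (cmod (a i))\<^sup>2 / U"
      using U by (simp add: zu norm_divide power_divide)
    ultimately show ?thesis by simp
  qed
  \<comment> \<open>Measured from \<open>lam (r+1)\<close>, the weights are nonnegative up to
    \<open>r\<close> and nonpositive beyond. So dropping the tail and raising each remaining
    \<open>p i\<close> to its bound can only increase the sum, while the total of the
    \<open>p i\<close> is fixed.\<close>
  let ?d = "\<lambda>i. lam i - lam (r+1)"
  have "(\<Sum>j=l..r. mu j) \<le> (\<Sum>j=l..r. \<Sum>i=1..n. lam i * (cmod (x j i))\<^sup>2)"
    by (intro sum_mono mu_le)
  also have "\<dots> = (\<Sum>i=1..n. lam i * p i)"
    unfolding p_def sum_distrib_left by (rule sum.swap)
  also have "\<dots> = (\<Sum>i=l..n. lam i * p i)" using p0 by (intro restrict) simp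
  also have "\<dots> = (\<Sum>i=l..n. ?d i * p i) + lam (r+1) * (\<Sum>i=l..n. p i)"
    by (simp add: left_diff_distrib sum_subtractf sum_distrib_left)
  also have "(\<Sum>i=l..n. ?d i * p i) \<le> (\<Sum>i=l..r. ?d i * p i)"
  proof -
    have "(\<Sum>i=l..n. ?d i * p i) = (\<Sum>i=l..r. ?d i * p i) + (\<Sum>i=Suc r..n. ?d i * p i)"
      using lr rn by (subst sum.union_disjoint[symmetric]) (auto intro!: sum.cong)
    moreover have "(\<Sum>i=Suc r..n. ?d i * p i) \<le> 0"
      using lam_dec p_nonneg by (intro sum_nonpos mult_nonpos_nonneg) auto
    ultimately show ?thesis by simp
  qed
  also have "(\<Sum>i=l..r. ?d i * p i) \<le> (\<Sum>i=l..r. ?d i * (1 - (cmod (a i))\<^sup>2 / U))"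
    using lam_dec lr rn p_le by (intro sum_mono mult_left_mono) auto
  also have "(\<Sum>i=l..r. ?d i * (1 - (cmod (a i))\<^sup>2 / U)) + lam (r+1) * (\<Sum>i=l..n. p i)
      = (\<Sum>j=l..r. lam j) - (\<Sum>j=l..r. ?d j * ((cmod (a j))\<^sup>2 / U))"
    unfolding p_sum right_diff_distrib by (simp add: sum_subtractf)
  finally show ?thesis unfolding U_def by simp
qed

text \<open>Negating the form reverses the order of the eigenvalues, so indices are reflected to
  keep both sequences decreasing: about \<open>n + 1\<close> for the \<open>n\<close> coordinates,
  about \<open>n\<close> for the \<open>n - 1\<close> compressed eigenvalues.\<close>

lemma reversed:
  "bordered_spectrum n (\<lambda>i. - lam (n + 1 - i)) (\<lambda>j. - mu (n - j))
    (\<lambda>j i. Y (n - j) (n + 1 - i)) (\<lambda>i. a (n + 1 - i))"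
proof -
  have rev: "(\<Sum>i=1..n. G (n + 1 - i)) = (\<Sum>i=1..n. G i)" for G :: "nat \<Rightarrow> complex"
    by (rule sum.reindex_bij_witness[of _ "\<lambda>i. n + 1 - i" "\<lambda>i. n + 1 - i"]) auto
  show ?thesis
  proof
    fix s t assume st: "s \<in> {1..n-1}" "t \<in> {1..n-1}"
    then have st': "n - s \<in> {1..n-1}" "n - t \<in> {1..n-1}" "n - s = n - t \<longleftrightarrow> s = t" by auto
    show "(\<Sum>i=1..n. Y (n - s) (n + 1 - i) * cnj (Y (n - t) (n + 1 - i))) = (if s = t then 1 else 0)"
      using orth[OF st'(1,2)] st'(3) rev[of "\<lambda>i. Y (n - s) i * cnj (Y (n - t) i)"] by simp
    show "(\<Sum>i=1..n. of_real (- lam (n + 1 - i)) *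
        (Y (n - s) (n + 1 - i) * cnj (Y (n - t) (n + 1 - i)))) = (if s = t then of_real (- mu (n - s)) else 0)"
      using diag[OF st'(1,2)] st'(3)
        rev[of "\<lambda>i. of_real (- lam i) * (Y (n - s) i * cnj (Y (n - t) i))"]
      by (simp add: sum_negf)
  next
    fix t assume "t \<in> {1..n-1}"
    then have "n - t \<in> {1..n-1}" by auto
    then show "(\<Sum>i=1..n. Y (n - t) (n + 1 - i) * a (n + 1 - i)) = 0"
      using perp rev[of "\<lambda>i. Y (n - t) i * a i"] by simp
  qed (use lam_dec mu_dec in auto)
qed

text \<open>This is the upper bound for the negated form and the reflected block from
  \<open>n - r\<close> to \<open>n - l\<close>; the tail sum of the squared moduli of
  \<open>a\<close> becomes an initial sum.\<close>

lemma block_sum_lower: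
  assumes lr: "1 \<le> l" "l \<le> r" "r \<le> n - 1"
    and L_nz: "(\<Sum>i=1..r+1. (cmod (a i))\<^sup>2) \<noteq> 0"
  shows "(\<Sum>j=l..r. lam (j+1))
    + (\<Sum>j=l..r. (lam l - lam (j+1)) * ((cmod (a (j+1)))\<^sup>2 / (\<Sum>i=1..r+1. (cmod (a i))\<^sup>2)))
    \<le> (\<Sum>j=l..r. mu j)"
proof -
  have rev_mu: "(\<Sum>j=n-r..n-l. - mu (n - j)) = (\<Sum>j=l..r. - mu j)"
    by (rule sum.reindex_bij_witness[of _ "\<lambda>i. n - i" "\<lambda>i. n - i"]) (use lr in auto)
  \<comment> \<open>The two reflections differ by one, so the block \<open>l..r\<close> of the
    \<open>mu j\<close> is matched with \<open>l+1..r+1\<close> for the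
    \<open>lam i\<close>.\<close>
  have rev: "(\<Sum>j=n-r..n-l. G (n + 1 - j)) = (\<Sum>j=l..r. G (j + 1))" for G :: "nat \<Rightarrow> real"
    by (rule sum.reindex_bij_witness[of _ "\<lambda>i. n - i" "\<lambda>i. n - i"])
      (use lr in \<open>auto simp: Suc_diff_le\<close>)
  have L: "(\<Sum>i=n-r..n. (cmod (a (n + 1 - i)))\<^sup>2) = (\<Sum>i=1..r+1. (cmod (a i))\<^sup>2)"
    by (rule sum.reindex_bij_witness[of _ "\<lambda>i. n + 1 - i" "\<lambda>i. n + 1 - i"]) (use lr in auto)
  \<comment> \<open>The reference weight just after the reflected block is, up to sign,
    \<open>lam l\<close>.\<close>
  have last: "n + 1 - (n - l + 1) = l" using lr by auto
  have "1 \<le> n - r" "n - r \<le> n - l" "n - l \<le> n - 1" using lr by auto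
  from bordered_spectrum.block_sum_upper[OF reversed this, unfolded L, OF L_nz]
  have "(\<Sum>j=l..r. - mu j) \<le> (\<Sum>j=l..r. - lam (j+1))
    - (\<Sum>j=l..r. (- lam (j+1) - - lam l) * ((cmod (a (j+1)))\<^sup>2 / (\<Sum>i=1..r+1. (cmod (a i))\<^sup>2)))"
    unfolding rev_mu last rev[of "\<lambda>i. - lam i"]
      rev[of "\<lambda>i. (- lam i - - lam l) * ((cmod (a i))\<^sup>2 / (\<Sum>i=1..r+1. (cmod (a i))\<^sup>2))"] .
  then show ?thesis by (simp add: sum_negf algebra_simps)
qed

end

section \<open>Spectral theorem with eigenvalues in a prescribed order\<close>

text \<open>Schur triangularisation provides a flag of invariant subspaces with the
  \<open>mu j\<close> in the given order, and orthonormalising along the flag keeps the form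
  triangular. Hermitian symmetry then makes it diagonal. As the \<open>y j\<close> form a basis, the
  two inner product identities say that they are orthonormal eigenvectors.\<close>

lemma hermitian_orthonormal_eigenbasis:
  fixes C :: "complex mat" and mu :: "nat \<Rightarrow> real"
  assumes herm: "hermitian_mat C N"
    and cp: "char_poly C = (\<Prod>j\<in>{1..N}. [:- complex_of_real (mu j), 1:])"
  obtains y where
    "\<And>s t. s \<in> {1..N} \<Longrightarrow> t \<in> {1..N} \<Longrightarrow>
      (\<Sum>i<N. y s i * cnj (y t i)) = (if s = t then 1 else 0)"
    "\<And>s t. s \<in> {1..N} \<Longrightarrow> t \<in> {1..N} \<Longrightarrow>
      (\<Sum>i<N. (\<Sum>i'<N. C $$ (i,i') * y s i') * cnj (y t i)) = (if s = t then of_real (mu s) else 0)"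
proof -
  have C: "C \<in> carrier_mat N N" using herm by (simp add: hermitian_mat_def)
  have Cherm: "C $$ (i,j) = cnj (C $$ (j,i))" if "i < N" "j < N" for i j
    using herm that unfolding hermitian_mat_def by blast
  define es where "es = map (\<lambda>j. complex_of_real (mu j)) [1..<Suc N]"
  have "(\<Prod>e\<leftarrow>es. [:- e, 1:]) = (\<Prod>j\<leftarrow>[1..<Suc N]. [:- complex_of_real (mu j), 1:])"
    by (simp add: es_def comp_def del: upt_Suc)
  also have "\<dots> = char_poly C"
    unfolding cp prod.distinct_set_conv_list[OF distinct_upt, symmetric]
    by (simp only: set_upt atLeastLessThanSuc_atLeastAtMost)
  finally have cp': "char_poly C = (\<Prod>e\<leftarrow>es. [:- e, 1:])" by simp
  obtain B P Q where "schur_decomposition C es = (B, P, Q)"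
    by (cases "schur_decomposition C es") auto
  from schur_decomposition[OF C cp' this]
  have sim: "similar_mat_wit C B P Q" and ut: "upper_triangular B" and dg: "diag_mat B = es"
    by auto
  from similar_mat_witD2[OF C sim]
  have QP: "Q * P = 1\<^sub>m N" and CPBQ: "C = P * B * Q"
    and car: "B \<in> carrier_mat N N" "P \<in> carrier_mat N N" "Q \<in> carrier_mat N N" by auto
  have "C * P = P * B * (Q * P)"
    using car unfolding CPBQ by (intro assoc_mult_mat) auto
  then have CP: "C * P = P * B" using car unfolding QP by simp
  \<comment> \<open>The columns of \<open>P\<close>, numbered from 1 to match
    \<open>mu\<close>.\<close>
  define p where "p t i = P $$ (i, t - 1)" for t i
  define b where "b u t = B $$ (u - 1, t - 1)" for u t
  have bdiag: "b t t = of_real (mu t)" if t: "t \<in> {1..N}" for t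
  proof -
    obtain m where m: "t = Suc m" "m < N" using t by (cases t) auto
    have "B $$ (m, m) = diag_mat B ! m" using m car by (simp add: diag_mat_def)
    also have "\<dots> = of_real (mu t)"
      unfolding dg es_def using m by (simp del: upt_Suc)
    finally show ?thesis by (simp add: b_def m)
  qed
  have btri: "b u t = 0" if "u \<in> {1..N}" "t \<in> {1..<u}" for u t
    unfolding b_def using ut that car by (intro upper_triangularD) auto
  \<comment> \<open>The common bound \<open>s\<close>, rather than \<open>t\<close>, lets all images
    with \<open>t \<le> s\<close> be expanded over the same range; the extra terms lie below the
    diagonal of \<open>B\<close>.\<close>
  have Cp: "(\<Sum>i'<N. C $$ (i,i') * p t i') = (\<Sum>u\<in>{1..s}. b u t * p u i)"
    if i: "i < N" and ts: "t \<in> {1..s}" "s \<le> N" for i t s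
  proof -
    have t: "t - 1 < N" using ts by auto
    have "(\<Sum>i'<N. C $$ (i,i') * p t i') = (C * P) $$ (i, t - 1)"
      using i t C car by (simp add: p_def scalar_prod_def lessThan_atLeast0)
    also have "\<dots> = (\<Sum>u<N. b (Suc u) t * p (Suc u) i)"
      unfolding CP using i t car
      by (simp add: p_def b_def scalar_prod_def lessThan_atLeast0 mult.commute)
    also have "\<dots> = (\<Sum>u\<in>{1..N}. b u t * p u i)"
      by (simp only: One_nat_def sum.atLeast1_atMost_eq)
    also have "\<dots> = (\<Sum>u\<in>{1..s}. b u t * p u i)"
      using ts btri by (intro sum.mono_neutral_right) auto
    finally show ?thesis .
  qed
  have indep: "\<forall>t\<in>{1..j}. c t = 0"
    if z: "\<And>i. i \<in> {..<N} \<Longrightarrow> (\<Sum>t\<in>{1..j}. c t * p t i) = 0" and j: "j \<le> N" for c j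
  proof
    fix s assume s: "s \<in> {1..j}"
    \<comment> \<open>The rows of \<open>Q\<close> are dual to the columns of \<open>P\<close> and
      so read off the coefficients of a combination.\<close>
    have QPe: "(\<Sum>i<N. Q $$ (s - 1, i) * p t i) = (if t = s then 1 else 0)" if t: "t \<in> {1..j}" for t
    proof -
      have st: "s - 1 < N" "t - 1 < N" using s t j by auto
      then have "(\<Sum>i<N. Q $$ (s - 1, i) * p t i) = (Q * P) $$ (s - 1, t - 1)"
        using car by (simp add: p_def scalar_prod_def lessThan_atLeast0)
      then show ?thesis unfolding QP using s t st by auto
    qed
    have "0 = (\<Sum>i<N. Q $$ (s - 1, i) * (\<Sum>t\<in>{1..j}. c t * p t i))" using z by simp
    also have "\<dots> = (\<Sum>t\<in>{1..j}. c t * (\<Sum>i<N. Q $$ (s - 1, i) * p t i))"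
      unfolding sum_distrib_left by (subst sum.swap) (simp add: mult_ac)
    also have "\<dots> = (\<Sum>t\<in>{1..j}. if t = s then c t else 0)"
      by (rule sum.cong[OF refl]) (subst QPe, auto)
    also have "\<dots> = c s" using s by simp
    finally show "c s = 0" by simp
  qed
  \<comment> \<open>Orthogonality to the columns \<open>p t\<close> themselves, rather than to the vectors already
    chosen, makes the choices for different \<open>j\<close> independent of each other.\<close>
  have "\<exists>c. (\<Sum>i<N. (cmod (\<Sum>t\<in>{1..j}. c t * p t i))\<^sup>2) = 1 \<and>
      (\<forall>u\<in>{1..<j}. (\<Sum>i<N. (\<Sum>t\<in>{1..j}. c t * p t i) * cnj (p u i)) = 0)" if j: "j \<in> {1..N}" for j
  proof (rule unit_vector_in_span[of "{..<N}" "{1..<j}" "{1..j}" p "\<lambda>u i. cnj (p u i)"])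
    show "\<forall>t\<in>{1..j}. c t = 0" if "\<And>i. i \<in> {..<N} \<Longrightarrow> (\<Sum>t\<in>{1..j}. c t * p t i) = 0" for c
      by (rule indep) (use that j in auto)
  qed (use j in \<open>auto\<close>)
  then obtain c where
    c1: "\<And>j. j \<in> {1..N} \<Longrightarrow> (\<Sum>i<N. (cmod (\<Sum>t\<in>{1..j}. c j t * p t i))\<^sup>2) = 1" and
    c2: "\<And>j u. j \<in> {1..N} \<Longrightarrow> u \<in> {1..<j} \<Longrightarrow>
      (\<Sum>i<N. (\<Sum>t\<in>{1..j}. c j t * p t i) * cnj (p u i)) = 0"
    using bchoice[of "{1..N}" "\<lambda>j c. (\<Sum>i<N. (cmod (\<Sum>t\<in>{1..j}. c t * p t i))\<^sup>2) = 1 \<and>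
      (\<forall>u\<in>{1..<j}. (\<Sum>i<N. (\<Sum>t\<in>{1..j}. c t * p t i) * cnj (p u i)) = 0)"] by blast
  define y where "y j i = (\<Sum>t\<in>{1..j}. c j t * p t i)" for j i
  have yy: "(\<Sum>i<N. y j i * cnj (y j i)) = 1" if "j \<in> {1..N}" for j
    using c1[OF that] by (simp only: sum_mult_cnj_self y_def of_real_1)
  have yp: "(\<Sum>i<N. (\<Sum>u\<in>S. d u * p u i) * cnj (y j i)) = 0"
    if j: "j \<in> {1..N}" and S: "S \<subseteq> {1..<j}" for j S d
  proof -
    have "(\<Sum>i<N. p u i * cnj (y j i)) = 0" if "u \<in> S" for u
    proof -
      have "(\<Sum>i<N. y j i * cnj (p u i)) = 0" using c2[OF j, of u] S that by (auto simp: y_def)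
      from arg_cong[OF this, of cnj] show ?thesis by (simp add: mult.commute)
    qed
    moreover have "(\<Sum>i<N. (\<Sum>u\<in>S. d u * p u i) * cnj (y j i))
        = (\<Sum>u\<in>S. d u * (\<Sum>i<N. p u i * cnj (y j i)))"
      unfolding sum_distrib_left sum_distrib_right by (subst sum.swap) (simp add: mult_ac)
    ultimately show ?thesis by simp
  qed
  have yo: "(\<Sum>i<N. y s i * cnj (y t i)) = 0" if "t \<in> {1..N}" "s \<in> {1..<t}" for s t
  proof -
    have "{1..s} \<subseteq> {1..<t}" using that by auto
    from yp[OF that(1) this, of "c s"] show ?thesis unfolding y_def[of s] .
  qed
  define Cy where "Cy s i = (\<Sum>i'<N. C $$ (i,i') * y s i')" for s i
  \<comment> \<open>The flag is invariant, so the image \<open>Cy s\<close> of \<open>y s\<close> is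
    a combination of \<open>p 1, ..., p s\<close>; these are its coefficients.\<close>
  define d where "d s u = (\<Sum>t\<in>{1..s}. c s t * b u t)" for s u
  have Cy: "Cy s i = (\<Sum>u\<in>{1..s}. d s u * p u i)" if s: "s \<in> {1..N}" and i: "i < N" for s i
  proof -
    have "Cy s i = (\<Sum>t\<in>{1..s}. c s t * (\<Sum>i'<N. C $$ (i,i') * p t i'))"
      unfolding Cy_def y_def sum_distrib_left by (subst sum.swap) (simp add: mult_ac)
    also have "\<dots> = (\<Sum>t\<in>{1..s}. c s t * (\<Sum>u\<in>{1..s}. b u t * p u i))"
      using Cp[OF i] s by (intro sum.cong refl) auto
    also have "\<dots> = (\<Sum>u\<in>{1..s}. d s u * p u i)"
      unfolding d_def sum_distrib_left sum_distrib_right by (subst sum.swap) (simp add: mult_ac)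
    finally show ?thesis .
  qed
  have upper: "(\<Sum>i<N. Cy s i * cnj (y t i)) = 0" if "t \<in> {1..N}" "s \<in> {1..<t}" for s t
  proof -
    have "{1..s} \<subseteq> {1..<t}" and s: "s \<in> {1..N}" using that by auto
    from yp[OF that(1) this(1), of "d s"] show ?thesis using Cy[OF s] by simp
  qed
  \<comment> \<open>Since \<open>C\<close> is Hermitian, exchanging \<open>s\<close> and
    \<open>t\<close> conjugates the entry, which reduces this case to \<open>upper\<close>.\<close>
  have lower: "(\<Sum>i<N. Cy s i * cnj (y t i)) = 0" if "s \<in> {1..N}" "t \<in> {1..<s}" for s t
  proof -
    have "(\<Sum>i<N. Cy s i * cnj (y t i)) = (\<Sum>i<N. \<Sum>i'<N. C $$ (i,i') * y s i' * cnj (y t i))"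
      by (simp add: Cy_def sum_distrib_right)
    also have "\<dots> = (\<Sum>i'<N. \<Sum>i<N. C $$ (i,i') * y s i' * cnj (y t i))" by (rule sum.swap)
    also have "\<dots> = (\<Sum>i'<N. \<Sum>i<N. cnj (C $$ (i',i)) * y s i' * cnj (y t i))"
      by (intro sum.cong refl arg_cong2[of _ _ _ _ "(*)"] Cherm) auto
    also have "\<dots> = cnj (\<Sum>i'<N. Cy t i' * cnj (y s i'))"
      by (simp add: Cy_def sum_distrib_left mult_ac)
    finally show ?thesis using upper[OF that] by simp
  qed
  have dtop: "d s s = c s s * of_real (mu s)" if s: "s \<in> {1..N}" for s
  proof -
    have "d s s = (\<Sum>t\<in>{s}. c s t * b s t)"
      unfolding d_def using s btri[OF s] by (intro sum.mono_neutral_right) auto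
    then show ?thesis using bdiag[OF s] by simp
  qed
  \<comment> \<open>By \<open>dtop\<close>, the column \<open>p s\<close> cancels in
    \<open>Cy s - mu s * y s\<close>; what is left lies in the span of the earlier columns, to which
    \<open>y s\<close> is orthogonal.\<close>
  have diag: "(\<Sum>i<N. Cy s i * cnj (y s i)) = of_real (mu s)" if s: "s \<in> {1..N}" for s
  proof -
    have ins: "{1..s} = insert s {1..<s}" using s by auto
    have "Cy s i - of_real (mu s) * y s i
        = (\<Sum>u\<in>{1..<s}. (d s u - of_real (mu s) * c s u) * p u i)" if "i < N" for i
      unfolding Cy[OF s that] y_def ins
      by (simp add: dtop[OF s] sum_distrib_left left_diff_distrib sum_subtractf algebra_simps)
    then have "(\<Sum>i<N. (Cy s i - of_real (mu s) * y s i) * cnj (y s i)) = 0"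
      using yp[OF s order_refl, of "\<lambda>u. d s u - of_real (mu s) * c s u"] by simp
    then have "(\<Sum>i<N. Cy s i * cnj (y s i)) = of_real (mu s) * (\<Sum>i<N. y s i * cnj (y s i))"
      by (simp add: left_diff_distrib sum_subtractf sum_distrib_left mult.assoc)
    then show ?thesis using yy[OF s] by simp
  qed
  show ?thesis
  proof
    fix s t assume st: "s \<in> {1..N}" "t \<in> {1..N}"
    consider "s = t" | "s < t" | "t < s" by linarith
    then show "(\<Sum>i<N. y s i * cnj (y t i)) = (if s = t then 1 else 0)"
    proof cases
      case 3
      then show ?thesis using arg_cong[OF yo[of s t], of cnj] st by (simp add: mult.commute)
    qed (use yy yo st in auto)
    consider "s = t" | "s < t" | "t < s" by linarith
    then show "(\<Sum>i<N. (\<Sum>i'<N. C $$ (i,i') * y s i') * cnj (y t i))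
        = (if s = t then of_real (mu s) else 0)"
      unfolding Cy_def[symmetric] by cases (use diag upper lower st in auto)
  qed
qed

section \<open>From the matrix and its principal submatrix to coordinates\<close>

text \<open>Orthonormality says that the matrix of the \<open>v i\<close> has its adjoint as left
  inverse; being square, it has it as right inverse too, which resolves the identity. Replacing
  \<open>lam i\<close> times \<open>v i\<close> by its image under \<open>A\<close> then gives the
  spectral decomposition of \<open>A\<close>.\<close>

lemma orthonormal_eigenvectors_resolution:
  fixes A :: "complex mat" and lam :: "nat \<Rightarrow> real" and v :: "nat \<Rightarrow> complex vec"
  assumes A: "A \<in> carrier_mat n n"
    and v_dim: "\<And>i. 1 \<le> i \<Longrightarrow> i \<le> n \<Longrightarrow> v i \<in> carrier_vec n"
    and v_eig: "\<And>i. 1 \<le> i \<Longrightarrow> i \<le> n \<Longrightarrow> A *\<^sub>v v i = complex_of_real (lam i) \<cdot>\<^sub>v v i"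
    and v_orthonormal: "\<And>i j. 1 \<le> i \<Longrightarrow> i \<le> n \<Longrightarrow> 1 \<le> j \<Longrightarrow> j \<le> n \<Longrightarrow>
                 v i \<bullet>c v j = (if i = j then 1 else 0)"
    and st: "s < n" "t < n"
  shows "(\<Sum>i=1..n. v i $ s * cnj (v i $ t)) = (if s = t then 1 else 0)"
    and "(\<Sum>i=1..n. of_real (lam i) * (v i $ s * cnj (v i $ t))) = A $$ (s, t)"
proof -
  define V where "V = mat n n (\<lambda>(s,i). v (Suc i) $ s)"
  define W where "W = mat n n (\<lambda>(i,s). cnj (v (Suc i) $ s))"
  have VW: "V \<in> carrier_mat n n" "W \<in> carrier_mat n n" by (auto simp: V_def W_def)
  have "W * V = 1\<^sub>m n"
  proof (rule eq_matI)
    fix i j assume "i < dim_row (1\<^sub>m n :: complex mat)" "j < dim_col (1\<^sub>m n :: complex mat)"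
    then have ij: "i < n" "j < n" by auto
    have "(W * V) $$ (i,j) = v (Suc j) \<bullet>c v (Suc i)"
      using ij v_dim[of "Suc i"] v_dim[of "Suc j"]
      by (simp add: W_def V_def scalar_prod_def mult.commute)
    then show "(W * V) $$ (i,j) = 1\<^sub>m n $$ (i,j)" using ij v_orthonormal[of "Suc j" "Suc i"] by auto
  qed (use VW in auto)
  then have VWone: "V * W = 1\<^sub>m n" by (rule mat_mult_left_right_inverse[OF VW(2,1)])
  have res: "(\<Sum>i=1..n. v i $ s * cnj (v i $ t)) = (if s = t then 1 else 0)"
    if "s < n" "t < n" for s t
  proof -
    have "(V * W) $$ (s,t) = (\<Sum>i<n. v (Suc i) $ s * cnj (v (Suc i) $ t))"
      using that by (simp add: V_def W_def scalar_prod_def lessThan_atLeast0)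
    then show ?thesis using that unfolding VWone One_nat_def sum.atLeast1_atMost_eq by simp
  qed
  show "(\<Sum>i=1..n. v i $ s * cnj (v i $ t)) = (if s = t then 1 else 0)" by (rule res[OF st])
  have eig: "of_real (lam i) * v i $ s = (\<Sum>u<n. A $$ (s,u) * v i $ u)" if "i \<in> {1..n}" for i
  proof -
    have "(A *\<^sub>v v i) $ s = (\<Sum>u<n. A $$ (s,u) * v i $ u)"
      using A st v_dim[of i] that by (simp add: scalar_prod_def lessThan_atLeast0)
    moreover have "(A *\<^sub>v v i) $ s = of_real (lam i) * v i $ s"
      using v_eig[of i] v_dim[of i] st that by simp
    ultimately show ?thesis by simp
  qed
  have "(\<Sum>i=1..n. of_real (lam i) * (v i $ s * cnj (v i $ t)))
      = (\<Sum>i=1..n. \<Sum>u<n. A $$ (s,u) * (v i $ u * cnj (v i $ t)))"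
    by (rule sum.cong[OF refl])
      (simp only: mult.assoc[symmetric] eig sum_distrib_right)
  also have "\<dots> = (\<Sum>u<n. A $$ (s,u) * (\<Sum>i=1..n. v i $ u * cnj (v i $ t)))"
    unfolding sum_distrib_left by (rule sum.swap)
  also have "\<dots> = (\<Sum>u<n. if u = t then A $$ (s,u) else 0)"
    using res st(2) by (intro sum.cong refl) auto
  also have "\<dots> = A $$ (s,t)" using st by simp
  finally show "(\<Sum>i=1..n. of_real (lam i) * (v i $ s * cnj (v i $ t))) = A $$ (s, t)" .
qed

lemma hermitian_mat_delete:
  assumes herm: "hermitian_mat A (Suc N)" and k: "k < Suc N"
  shows "hermitian_mat (mat_delete A k k) N"
proof -
  have A: "A \<in> carrier_mat (Suc N) (Suc N)" using herm by (simp add: hermitian_mat_def)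
  have idx: "insert_index k i < Suc N" if "i < N" for i using that by (simp add: insert_index_def)
  have "mat_delete A k k $$ (i,j) = cnj (mat_delete A k k $$ (j,i))" if "i < N" "j < N" for i j
    unfolding mat_delete_index[OF A k k that, symmetric] mat_delete_index[OF A k k that(2,1), symmetric]
    using herm idx that unfolding hermitian_mat_def by blast
  moreover have "mat_delete A k k \<in> carrier_mat N N" using mat_delete_carrier[OF A] by simp
  ultimately show ?thesis unfolding hermitian_mat_def by blast
qed

text \<open>The family \<open>Y\<close> consists of orthonormal eigenvectors of the submatrix,
  padded with 0 at position \<open>k\<close> and expanded in the basis \<open>v\<close>. Changing to
  this basis preserves inner products and turns \<open>A\<close> into the weights
  \<open>lam\<close>.\<close>

lemma bordered_spectrum_mat_delete:
  fixes A :: "complex mat" and lam mu :: "nat \<Rightarrow> real" and v :: "nat \<Rightarrow> complex vec"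
  assumes herm: "hermitian_mat A n" and k: "k < n"
    and lam_dec: "\<And>i j. 1 \<le> i \<Longrightarrow> i \<le> j \<Longrightarrow> j \<le> n \<Longrightarrow> lam j \<le> lam i"
    and v_dim: "\<And>i. 1 \<le> i \<Longrightarrow> i \<le> n \<Longrightarrow> v i \<in> carrier_vec n"
    and v_eig: "\<And>i. 1 \<le> i \<Longrightarrow> i \<le> n \<Longrightarrow> A *\<^sub>v v i = complex_of_real (lam i) \<cdot>\<^sub>v v i"
    and v_orthonormal: "\<And>i j. 1 \<le> i \<Longrightarrow> i \<le> n \<Longrightarrow> 1 \<le> j \<Longrightarrow> j \<le> n \<Longrightarrow>
                 v i \<bullet>c v j = (if i = j then 1 else 0)"
    and mu_dec: "\<And>i j. 1 \<le> i \<Longrightarrow> i \<le> j \<Longrightarrow> j \<le> n - 1 \<Longrightarrow> mu j \<le> mu i"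
    and mu_eig: "char_poly (mat_delete A k k) = (\<Prod>j\<in>{1..n-1}. [:- complex_of_real (mu j), 1:])"
  shows "\<exists>Y. bordered_spectrum n lam mu Y (\<lambda>i. v i $ k)"
proof -
  define N where "N = n - 1"
  have n: "n = Suc N" using k by (simp add: N_def)
  have A: "A \<in> carrier_mat n n" using herm by (simp add: hermitian_mat_def)
  define C where "C = mat_delete A k k"
  have C: "hermitian_mat C N"
    unfolding C_def using herm k n by (intro hermitian_mat_delete) auto
  from hermitian_orthonormal_eigenbasis[OF C mu_eig[folded C_def N_def]]
  obtain y where y: "\<And>s t. s \<in> {1..N} \<Longrightarrow> t \<in> {1..N} \<Longrightarrow>
      (\<Sum>i<N. y s i * cnj (y t i)) = (if s = t then 1 else 0)"
    and Cy: "\<And>s t. s \<in> {1..N} \<Longrightarrow> t \<in> {1..N} \<Longrightarrow>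
      (\<Sum>i<N. (\<Sum>i'<N. C $$ (i,i') * y s i') * cnj (y t i)) = (if s = t then of_real (mu s) else 0)"
    by blast
  let ?i = "insert_index k"
  have idx: "?i i < n" "k \<noteq> ?i i" if "i < N" for i
    using that n by (auto simp: insert_index_def)
  have idx_inj: "?i i = ?i j \<longleftrightarrow> i = j" for i j
    by (auto simp: insert_index_def)
  note res = orthonormal_eigenvectors_resolution[OF A v_dim v_eig v_orthonormal]
  define Y where "Y j i = (\<Sum>u<N. y j u * cnj (v i $ ?i u))" for j i
  \<comment> \<open>With the sum over \<open>i\<close> innermost, the resolution formulas apply:
    weights 1 yield the identity matrix, weights \<open>lam\<close> the entries of \<open>A\<close>
    away from row and column \<open>k\<close>, which are those of \<open>C\<close>.\<close>
  have form: "(\<Sum>i=1..n. h i * (Y s i * cnj (Y t i)))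
      = (\<Sum>w<N. (\<Sum>u<N. (\<Sum>i=1..n. h i * (v i $ ?i w * cnj (v i $ ?i u))) * y s u) * cnj (y t w))"
    for h :: "nat \<Rightarrow> complex" and s t
  proof -
    have "Y s i * cnj (Y t i)
        = (\<Sum>u<N. \<Sum>w<N. (y s u * cnj (v i $ ?i u)) * (cnj (y t w) * v i $ ?i w))" for i
      unfolding sum_product[symmetric] by (simp add: Y_def)
    then have "(\<Sum>i=1..n. h i * (Y s i * cnj (Y t i)))
        = (\<Sum>i=1..n. \<Sum>u<N. \<Sum>w<N. h i * (v i $ ?i w * cnj (v i $ ?i u)) * y s u * cnj (y t w))"
      by (simp add: sum_distrib_left mult_ac)
    also have "\<dots> = (\<Sum>u<N. \<Sum>i=1..n. \<Sum>w<N. h i * (v i $ ?i w * cnj (v i $ ?i u)) * y s u * cnj (y t w))"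
      by (rule sum.swap)
    also have "\<dots> = (\<Sum>u<N. \<Sum>w<N. \<Sum>i=1..n. h i * (v i $ ?i w * cnj (v i $ ?i u)) * y s u * cnj (y t w))"
      by (rule sum.cong[OF refl], rule sum.swap)
    also have "\<dots> = (\<Sum>w<N. \<Sum>u<N. \<Sum>i=1..n. h i * (v i $ ?i w * cnj (v i $ ?i u)) * y s u * cnj (y t w))"
      by (rule sum.swap)
    finally show ?thesis by (simp only: sum_distrib_right)
  qed
  have "bordered_spectrum n lam mu Y (\<lambda>i. v i $ k)"
  proof
    fix s t assume "s \<in> {1..n-1}" "t \<in> {1..n-1}"
    then have st: "s \<in> {1..N}" "t \<in> {1..N}" by (auto simp: N_def)
    have "(\<Sum>i=1..n. Y s i * cnj (Y t i))
        = (\<Sum>w<N. (\<Sum>u<N. (\<Sum>i=1..n. v i $ ?i w * cnj (v i $ ?i u)) * y s u) * cnj (y t w))"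
      using form[of "\<lambda>_. 1" s t] by simp
    also have "\<dots> = (\<Sum>w<N. (\<Sum>u<N. if w = u then y s u else 0) * cnj (y t w))"
      by (intro sum.cong refl arg_cong2[of _ _ _ _ "(*)"]) (simp add: res(1) idx(1) idx_inj del: One_nat_def)
    also have "\<dots> = (\<Sum>w<N. y s w * cnj (y t w))" by simp
    finally show "(\<Sum>i=1..n. Y s i * cnj (Y t i)) = (if s = t then 1 else 0)"
      using y[OF st] by simp
    have "(\<Sum>i=1..n. of_real (lam i) * (Y s i * cnj (Y t i)))
        = (\<Sum>w<N. (\<Sum>u<N. C $$ (w,u) * y s u) * cnj (y t w))"
      unfolding form
    proof (intro sum.cong refl arg_cong2[of _ _ _ _ "(*)"])
      fix w u assume "w \<in> {..<N}" "u \<in> {..<N}"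
      then have wu: "w < N" "u < N" by auto
      show "(\<Sum>i=1..n. of_real (lam i) * (v i $ ?i w * cnj (v i $ ?i u))) = C $$ (w,u)"
        unfolding C_def using mat_delete_index[of A N k k w u] A n k wu res(2) idx by auto
    qed
    then show "(\<Sum>i=1..n. of_real (lam i) * (Y s i * cnj (Y t i)))
        = (if s = t then of_real (mu s) else 0)"
      using Cy[OF st] by simp
  next
    fix t
    \<comment> \<open>The \<open>k\<close>-th unit vector has coordinates
      \<open>cnj (v i $ k)\<close>, so its inner product with the padded \<open>y t\<close> involves
      \<open>v i $ k\<close> unconjugated. It vanishes because the padding is 0 there.\<close>
    have "(\<Sum>i=1..n. Y t i * v i $ k) = (\<Sum>u<N. y t u * (\<Sum>i=1..n. v i $ k * cnj (v i $ ?i u)))"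
      unfolding Y_def sum_distrib_left sum_distrib_right by (subst sum.swap) (simp add: mult_ac)
    also have "\<dots> = 0"
    proof (rule sum.neutral, rule ballI)
      fix u assume "u \<in> {..<N}"
      then have "?i u < n" "k \<noteq> ?i u" using idx[of u] by auto
      then show "y t u * (\<Sum>i=1..n. v i $ k * cnj (v i $ ?i u)) = 0"
        using res(1)[of k "?i u"] k by simp
    qed
    finally show "(\<Sum>i=1..n. Y t i * v i $ k) = 0" .
  qed (use lam_dec mu_dec in auto)
  then show ?thesis by blast
qed

section \<open>Summation over all deleted indices\<close>

theorem theorem3p4:
  fixes A :: "complex mat" and n :: nat
    and lam :: "nat \<Rightarrow> real" and v :: "nat \<Rightarrow> complex vec"
    and mu :: "nat \<Rightarrow> nat \<Rightarrow> real" and l r :: nat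
  assumes n2: "n \<ge> 2"
    and herm: "hermitian_mat A n"
    and lam_dec: "\<And>i j. 1 \<le> i \<Longrightarrow> i \<le> j \<Longrightarrow> j \<le> n \<Longrightarrow> lam j \<le> lam i"
    and v_dim: "\<And>i. 1 \<le> i \<Longrightarrow> i \<le> n \<Longrightarrow> v i \<in> carrier_vec n"
    and v_eig: "\<And>i. 1 \<le> i \<Longrightarrow> i \<le> n \<Longrightarrow> A *\<^sub>v v i = complex_of_real (lam i) \<cdot>\<^sub>v v i"
    and v_orthonormal: "\<And>i j. 1 \<le> i \<Longrightarrow> i \<le> n \<Longrightarrow> 1 \<le> j \<Longrightarrow> j \<le> n \<Longrightarrow>
                 v i \<bullet>c v j = (if i = j then 1 else 0)"
    and mu_dec: "\<And>k i j. 1 \<le> k \<Longrightarrow> k \<le> n \<Longrightarrow> 1 \<le> i \<Longrightarrow> i \<le> j \<Longrightarrow> j \<le> n - 1 \<Longrightarrow>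
                 mu k j \<le> mu k i"
    and mu_eig: "\<And>k. 1 \<le> k \<Longrightarrow> k \<le> n \<Longrightarrow>
                 char_poly (principal_sub A k) = (\<Prod>j\<in>{1..n-1}. [:- complex_of_real (mu k j), 1:])"
    and lr: "1 \<le> l" "l \<le> r" "r \<le> n - 1"
    and U_nz: "\<And>k. 1 \<le> k \<Longrightarrow> k \<le> n \<Longrightarrow> (\<Sum>i=l..n. (cmod (v i $ (k - 1)))\<^sup>2) \<noteq> 0"
    and L_nz: "\<And>k. 1 \<le> k \<Longrightarrow> k \<le> n \<Longrightarrow> (\<Sum>i=1..r+1. (cmod (v i $ (k - 1)))\<^sup>2) \<noteq> 0"
  shows "let U = (\<lambda>k. \<Sum>i=l..n. (cmod (v i $ (k - 1)))\<^sup>2);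
             L = (\<lambda>k. \<Sum>i=1..r+1. (cmod (v i $ (k - 1)))\<^sup>2);
             \<Omega> = (\<lambda>j. \<Sum>k=1..n. (cmod (v j $ (k - 1)))\<^sup>2 / U k);
             \<Psi> = (\<lambda>j. \<Sum>k=1..n. (cmod (v j $ (k - 1)))\<^sup>2 / L k)
         in real n * (\<Sum>j=l..r. lam (j+1)) + (\<Sum>j=l..r. (lam l - lam (j+1)) * \<Psi> (j+1))
              \<le> (\<Sum>k=1..n. \<Sum>j=l..r. mu k j)
          \<and> (\<Sum>k=1..n. \<Sum>j=l..r. mu k j)
              \<le> real n * (\<Sum>j=l..r. lam j) - (\<Sum>j=l..r. (lam j - lam (r+1)) * \<Omega> j)"
proof -
  define U where "U k = (\<Sum>i=l..n. (cmod (v i $ (k - 1)))\<^sup>2)" for k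
  define L where "L k = (\<Sum>i=1..r+1. (cmod (v i $ (k - 1)))\<^sup>2)" for k
  have lower: "(\<Sum>j=l..r. lam (j+1)) + (\<Sum>j=l..r. (lam l - lam (j+1)) * ((cmod (v (j+1) $ (k - 1)))\<^sup>2 / L k))
      \<le> (\<Sum>j=l..r. mu k j)" (is "?lower k")
    and upper: "(\<Sum>j=l..r. mu k j) \<le>
      (\<Sum>j=l..r. lam j) - (\<Sum>j=l..r. (lam j - lam (r+1)) * ((cmod (v j $ (k - 1)))\<^sup>2 / U k))" (is "?upper k")
    if k: "k \<in> {1..n}" for k
  proof -
    have k': "1 \<le> k" "k \<le> n" "k - 1 < n" using k by auto
    have "\<exists>Y. bordered_spectrum n lam (mu k) Y (\<lambda>i. v i $ (k - 1))"
      by (rule bordered_spectrum_mat_delete[OF herm k'(3) lam_dec v_dim v_eig v_orthonormal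
            mu_dec[OF k'(1,2)] mu_eig[OF k'(1,2), unfolded principal_sub_def]])
    then obtain Y where Y: "bordered_spectrum n lam (mu k) Y (\<lambda>i. v i $ (k - 1))" ..
    show "?lower k" unfolding L_def
      by (rule bordered_spectrum.block_sum_lower[OF Y lr L_nz[OF k'(1,2)]])
    show "?upper k" unfolding U_def
      by (rule bordered_spectrum.block_sum_upper[OF Y lr U_nz[OF k'(1,2)]])
  qed
  \<comment> \<open>Moving the sum over \<open>k\<close> inside collects the quotients into
    \<open>\<Omega>\<close> and \<open>\<Psi>\<close>; the terms free of \<open>k\<close> acquire
    the factor \<open>n\<close>.\<close>
  have exchange: "(\<Sum>k=1..n. \<Sum>j=l..r. D j * E j k) = (\<Sum>j=l..r. D j * (\<Sum>k=1..n. E j k))"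
    for D :: "nat \<Rightarrow> real" and E :: "nat \<Rightarrow> nat \<Rightarrow> real"
    unfolding sum_distrib_left by (rule sum.swap)
  have const: "(\<Sum>k=1..n. c) = real n * c" for c :: real by simp
  have "(\<Sum>k=1..n. (\<Sum>j=l..r. lam (j+1))
      + (\<Sum>j=l..r. (lam l - lam (j+1)) * ((cmod (v (j+1) $ (k - 1)))\<^sup>2 / L k)))
      \<le> (\<Sum>k=1..n. \<Sum>j=l..r. mu k j)"
    by (rule sum_mono) (rule lower)
  moreover have "(\<Sum>k=1..n. \<Sum>j=l..r. mu k j) \<le> (\<Sum>k=1..n. (\<Sum>j=l..r. lam j)
      - (\<Sum>j=l..r. (lam j - lam (r+1)) * ((cmod (v j $ (k - 1)))\<^sup>2 / U k)))"
    by (rule sum_mono) (rule upper)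
  ultimately show ?thesis
    unfolding Let_def U_def[symmetric] L_def[symmetric] sum.distrib sum_subtractf exchange const
    by (rule conjI)
qed

end
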